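(* Let $G$, $H$, $K$, and $I$ be finite groups, and let $R$ be a commutative ring such that $|H|$ and $|K|$ are invertible in $R$. For any subgroups $L\le G\times H$, $M\le H\times K$, and $N\le K\times I$, the $2$-cocycle relation $$\kappa(L,M)\cdot\kappa(L*M,N)=\kappa(L,M*N)\cdot\kappa(M,N)$$ holds in $R^\times$. In particular, the bilinear maps $-*_H^\kappa-$ and $-*_K^\kappa-$ behave associatively: $$(L*_H^\kappa M)*_K^\kappa N=L*_H^\kappa(M*_K^\kappa N).$$ Moreover, if $|G|$ is invertible in $R$ then the $R$-module $R\mathscr{S}_{G\times G}$ together with the multiplication $*_G^\kappa$ is an $R$-algebra with identity element $|G|\cdot\Delta(G)$.
   Context: For a finite group $X$, $\mathscr{S}_X$ is the set of subgroups of $X$ and $R\mathscr{S}_X$ is the free $R$-module with basis $\mathscr{S}_X$. For $L\le G\times H$ put $k_1(L)=\{g\in G\mid (g,1)\in L\}$ and $k_2(L)=\{h\in H\mid(1,h)\in L\}$. For $L\le G\times H$ and $M\le H\times K$ the subgroup $L*M\le G\times K$ is $$L*M=\{(g,k)\in G\times K\mid \exists\,h\in H:\ (g,h)\in L,\ (h,k)\in M\}.$$ If $|H|$ is invertible in $R$, define $\kappa(L,M):=\frac{|k_2(L)\cap k_1(M)|}{|H|}\in R$ and let $-*_H^\kappa-\colon R\mathscr{S}_{G\times H}\times R\mathscr{S}_{H\times K}\to R\mathscr{S}_{G\times K}$ be the $R$-bilinear map with $L*_H^\kappa M:=\kappa(L,M)\cdot(L*M)$. (In $\kappa(M,N)$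 for $M\le H\times K$, $N\le K\times I$ the denominator is $|K|$, and similarly for the other pairs: the denominator is the order of the middle group.) $\Delta(G)=\{(g,g)\mid g\in G\}\le G\times G$. *)

theory Defs
  imports "HOL-Algebra.Coset" "HOL-Algebra.Module"
begin

section \<open>Free modules and non-commutative algebras\<close>

text \<open>The free \<open>R\<close>-module with basis \<open>B\<close>: finitely supported functions \<open>B \<rightarrow> R\<close>. The record type of
  modules extends that of rings; the multiplicative fields play no role in a module.\<close>

definition free_module :: "('r, 'm) ring_scheme \<Rightarrow> 'b set \<Rightarrow> ('r, 'b \<Rightarrow> 'r) module" where
  "free_module R B =
    \<lparr>carrier = {f \<in> B \<rightarrow>\<^sub>E carrier R. finite {x \<in> B. f x \<noteq> \<zero>\<^bsub>R\<^esub>}},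
     mult = undefined,
     one = undefined,
     zero = (\<lambda>x\<in>B. \<zero>\<^bsub>R\<^esub>),
     add = (\<lambda>f g. \<lambda>x\<in>B. f x \<oplus>\<^bsub>R\<^esub> g x),
     smult = (\<lambda>r f. \<lambda>x\<in>B. r \<otimes>\<^bsub>R\<^esub> f x)\<rparr>"

definition basis_elem :: "('r, 'm) ring_scheme \<Rightarrow> 'b set \<Rightarrow> 'b \<Rightarrow> 'b \<Rightarrow> 'r" where
  "basis_elem R B b = (\<lambda>x\<in>B. if x = b then \<one>\<^bsub>R\<^esub> else \<zero>\<^bsub>R\<^esub>)"

text \<open>The locale \<open>algebra\<close> of HOL-Algebra requires the multiplication to be commutative. This is the
  version for associative unital algebras.\<close>

locale assoc_algebra = module + ring M +
  assumes smult_mult_left: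
      "\<lbrakk>a \<in> carrier R; x \<in> carrier M; y \<in> carrier M\<rbrakk> \<Longrightarrow>
        (a \<odot>\<^bsub>M\<^esub> x) \<otimes>\<^bsub>M\<^esub> y = a \<odot>\<^bsub>M\<^esub> (x \<otimes>\<^bsub>M\<^esub> y)"
    and smult_mult_right:
      "\<lbrakk>a \<in> carrier R; x \<in> carrier M; y \<in> carrier M\<rbrakk> \<Longrightarrow>
        x \<otimes>\<^bsub>M\<^esub> (a \<odot>\<^bsub>M\<^esub> y) = a \<odot>\<^bsub>M\<^esub> (x \<otimes>\<^bsub>M\<^esub> y)"


section \<open>Subgroups of direct products\<close>

definition subgroups_of :: "('a, 'm) monoid_scheme \<Rightarrow> 'a set set" where
  "subgroups_of X = {S. subgroup S X}"

definition k1 :: "('a, 'm) monoid_scheme \<Rightarrow> ('b, 'n) monoid_scheme \<Rightarrow> ('a \<times> 'b) set \<Rightarrow> 'a set" where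
  "k1 G H L = {g \<in> carrier G. (g, \<one>\<^bsub>H\<^esub>) \<in> L}"

definition k2 :: "('a, 'm) monoid_scheme \<Rightarrow> ('b, 'n) monoid_scheme \<Rightarrow> ('a \<times> 'b) set \<Rightarrow> 'b set" where
  "k2 G H L = {h \<in> carrier H. (\<one>\<^bsub>G\<^esub>, h) \<in> L}"

definition star :: "('a, 'm) monoid_scheme \<Rightarrow> ('b, 'n) monoid_scheme \<Rightarrow> ('c, 'o) monoid_scheme \<Rightarrow>
    ('a \<times> 'b) set \<Rightarrow> ('b \<times> 'c) set \<Rightarrow> ('a \<times> 'c) set" where
  "star G H K L M = {(g, k) \<in> carrier G \<times> carrier K. \<exists>h\<in>carrier H. (g, h) \<in> L \<and> (h, k) \<in> M}"

definition diagonal :: "('a, 'm) monoid_scheme \<Rightarrow> ('a \<times> 'a) set" where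
  "diagonal G = {(g, g) | g. g \<in> carrier G}"

text \<open>The image of a natural number in \<open>R\<close>.\<close>

abbreviation nat_in :: "('r, 'm) ring_scheme \<Rightarrow> nat \<Rightarrow> 'r" where
  "nat_in R n \<equiv> [n] \<cdot>\<^bsub>R\<^esub> \<one>\<^bsub>R\<^esub>"

text \<open>Meaningful only if the order of the middle group \<open>H\<close> is invertible in \<open>R\<close>.\<close>

definition kappa :: "('r, 'l) ring_scheme \<Rightarrow> ('a, 'm) monoid_scheme \<Rightarrow> ('b, 'n) monoid_scheme \<Rightarrow>
    ('c, 'o) monoid_scheme \<Rightarrow> ('a \<times> 'b) set \<Rightarrow> ('b \<times> 'c) set \<Rightarrow> 'r" where
  "kappa R G H K L M =
    nat_in R (card (k2 G H L \<inter> k1 H K M)) \<otimes>\<^bsub>R\<^esub> inv\<^bsub>R\<^esub> (nat_in R (order H))"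


section \<open>The twisted product\<close>

abbreviation RS :: "('r, 'l) ring_scheme \<Rightarrow> ('a, 'm) monoid_scheme \<Rightarrow> ('r, 'a set \<Rightarrow> 'r) module" where
  "RS R X \<equiv> free_module R (subgroups_of X)"

abbreviation sbasis :: "('r, 'l) ring_scheme \<Rightarrow> ('a, 'm) monoid_scheme \<Rightarrow> 'a set \<Rightarrow> 'a set \<Rightarrow> 'r" where
  "sbasis R X \<equiv> basis_elem R (subgroups_of X)"

text \<open>The bilinear extension, for finite groups, of \<open>(L, M) \<mapsto> \<kappa>(L, M) \<cdot> (L * M)\<close>; see the lemmas
  \<open>kstar_basis\<close>, \<open>kstar_add_left\<close>, \<open>kstar_add_right\<close>, \<open>kstar_smult_left\<close>, \<open>kstar_smult_right\<close> below.\<close>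

definition kstar :: "('r, 'l) ring_scheme \<Rightarrow> ('a, 'm) monoid_scheme \<Rightarrow> ('b, 'n) monoid_scheme \<Rightarrow>
    ('c, 'o) monoid_scheme \<Rightarrow> (('a \<times> 'b) set \<Rightarrow> 'r) \<Rightarrow> (('b \<times> 'c) set \<Rightarrow> 'r) \<Rightarrow> (('a \<times> 'c) set \<Rightarrow> 'r)" where
  "kstar R G H K x y =
    finsum (RS R (G \<times>\<times> K))
      (\<lambda>(L, M). (x L \<otimes>\<^bsub>R\<^esub> y M \<otimes>\<^bsub>R\<^esub> kappa R G H K L M) \<odot>\<^bsub>RS R (G \<times>\<times> K)\<^esub>
          sbasis R (G \<times>\<times> K) (star G H K L M))
      (subgroups_of (G \<times>\<times> H) \<times> subgroups_of (H \<times>\<times> K))"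


section \<open>Well-definedness\<close>

lemma free_module_closedI:
  assumes "\<And>z. z \<in> B \<Longrightarrow> f z \<in> carrier R" and "finite A" and "{z \<in> B. f z \<noteq> \<zero>\<^bsub>R\<^esub>} \<subseteq> A"
  shows "(\<lambda>z\<in>B. f z) \<in> carrier (free_module R B)"
proof -
  have "{z \<in> B. (\<lambda>z\<in>B. f z) z \<noteq> \<zero>\<^bsub>R\<^esub>} = {z \<in> B. f z \<noteq> \<zero>\<^bsub>R\<^esub>}"
    by auto
  moreover have "finite {z \<in> B. f z \<noteq> \<zero>\<^bsub>R\<^esub>}"
    using assms(2,3) by (rule finite_subset[rotated])
  ultimately show ?thesis
    using assms(1) by (simp add: free_module_def)
qed

lemma free_moduleD:
  assumes "f \<in> carrier (free_module R B)"
  shows "f \<in> B \<rightarrow>\<^sub>E carrier R" "finite {z \<in> B. f z \<noteq> \<zero>\<^bsub>R\<^esub>}"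
  using assms by (simp_all add: free_module_def)

lemma free_module_module:
  assumes "cring R"
  shows "module R (free_module R B)"
proof -
  interpret cring R by fact
  have ag: "abelian_group (free_module R B)"
  proof (rule abelian_groupI, goal_cases)
    case (1 x y)
    note D = free_moduleD[OF 1(1)] free_moduleD[OF 1(2)]
    have "(\<lambda>z\<in>B. x z \<oplus>\<^bsub>R\<^esub> y z) \<in> carrier (free_module R B)"
      by (rule free_module_closedI[where A = "{z \<in> B. x z \<noteq> \<zero>\<^bsub>R\<^esub>} \<union> {z \<in> B. y z \<noteq> \<zero>\<^bsub>R\<^esub>}"])
        (use D in auto)
    then show ?case by (simp add: free_module_def)
  next
    case 2
    have "(\<lambda>z\<in>B. \<zero>\<^bsub>R\<^esub>) \<in> carrier (free_module R B)"
      by (rule free_module_closedI[where A = "{}"]) auto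
    then show ?case by (simp add: free_module_def)
  next
    case (6 x)
    note D = free_moduleD[OF 6]
    let ?y = "\<lambda>z\<in>B. \<ominus>\<^bsub>R\<^esub> x z"
    have "?y \<in> carrier (free_module R B)"
      by (rule free_module_closedI[where A = "{z \<in> B. x z \<noteq> \<zero>\<^bsub>R\<^esub>}"]) (use D in auto)
    moreover have "?y \<oplus>\<^bsub>free_module R B\<^esub> x = \<zero>\<^bsub>free_module R B\<^esub>"
      using D by (auto simp: free_module_def PiE_iff l_neg intro!: restrict_ext)
    ultimately show ?case by blast
  qed (auto simp: free_module_def PiE_iff extensional_def fun_eq_iff a_ac)
  show ?thesis
  proof (rule moduleI[OF assms ag], goal_cases)
    case (1 a x)
    note D = free_moduleD[OF 1(2)]
    have "(\<lambda>z\<in>B. a \<otimes>\<^bsub>R\<^esub> x z) \<in> carrier (free_module R B)"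
      by (rule free_module_closedI[where A = "{z \<in> B. x z \<noteq> \<zero>\<^bsub>R\<^esub>}"]) (use D 1(1) in auto)
    then show ?case by (simp add: free_module_def)
  qed (auto simp: free_module_def PiE_iff extensional_def fun_eq_iff l_distr r_distr m_assoc)
qed

lemma free_module_add: "b \<in> B \<Longrightarrow> (f \<oplus>\<^bsub>free_module R B\<^esub> g) b = f b \<oplus>\<^bsub>R\<^esub> g b"
  by (simp add: free_module_def)

lemma free_module_smult: "b \<in> B \<Longrightarrow> (r \<odot>\<^bsub>free_module R B\<^esub> f) b = r \<otimes>\<^bsub>R\<^esub> f b"
  by (simp add: free_module_def)

lemma basis_elem_closed:
  assumes "cring R"
  shows "basis_elem R B b \<in> carrier (free_module R B)"
proof -
  interpret cring R by fact
  show ?thesis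
    unfolding basis_elem_def by (rule free_module_closedI[where A = "{b}"]) auto
qed

lemma finite_subgroups_of: "finite (carrier X) \<Longrightarrow> finite (subgroups_of X)"
  by (rule finite_subset[of _ "Pow (carrier X)"]) (auto simp: subgroups_of_def dest: subgroup.subset)

lemma star_subgroup:
  assumes "group G" "group H" "group K"
    and "subgroup L (G \<times>\<times> H)" "subgroup M (H \<times>\<times> K)"
  shows "subgroup (star G H K L M) (G \<times>\<times> K)"
proof -
  interpret G: group G by fact
  interpret H: group H by fact
  interpret K: group K by fact
  interpret GK: group "G \<times>\<times> K" by (rule DirProd_group) fact+
  interpret L: subgroup L "G \<times>\<times> H" by fact
  interpret M: subgroup M "H \<times>\<times> K" by fact
  show ?thesis
  proof (rule GK.subgroupI, goal_cases)
    case 1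
    show ?case by (auto simp: star_def)
  next
    case 2
    have "(\<one>\<^bsub>G\<^esub>, \<one>\<^bsub>K\<^esub>) \<in> star G H K L M"
      using L.one_closed M.one_closed by (auto simp: star_def)
    then show ?case by blast
  next
    case (3 a)
    then obtain g h k where *: "a = (g, k)" "g \<in> carrier G" "h \<in> carrier H" "k \<in> carrier K"
        "(g, h) \<in> L" "(h, k) \<in> M"
      by (auto simp: star_def)
    have "(inv\<^bsub>G\<^esub> g, inv\<^bsub>H\<^esub> h) \<in> L" "(inv\<^bsub>H\<^esub> h, inv\<^bsub>K\<^esub> k) \<in> M"
      using L.m_inv_closed[OF *(5)] M.m_inv_closed[OF *(6)] * assms(1-3) by auto
    with * show ?case
      using assms(1-3) by (auto simp: star_def)
  next
    case (4 a b)
    then obtain g h k g' h' k' where *: "a = (g, k)" "g \<in> carrier G" "h \<in> carrier H" "k \<in> carrier K"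
        "(g, h) \<in> L" "(h, k) \<in> M" "b = (g', k')" "g' \<in> carrier G" "h' \<in> carrier H" "k' \<in> carrier K"
        "(g', h') \<in> L" "(h', k') \<in> M"
      by (auto simp: star_def)
    have "(g \<otimes>\<^bsub>G\<^esub> g', h \<otimes>\<^bsub>H\<^esub> h') \<in> L" "(h \<otimes>\<^bsub>H\<^esub> h', k \<otimes>\<^bsub>K\<^esub> k') \<in> M"
      using L.m_closed[OF *(5) *(11)] M.m_closed[OF *(6) *(12)] by auto
    with * show ?case by (auto simp: star_def)
  qed
qed

lemma diagonal_subgroup:
  assumes "group G"
  shows "subgroup (diagonal G) (G \<times>\<times> G)"
proof -
  interpret G: group G by fact
  interpret GG: group "G \<times>\<times> G" by (rule DirProd_group) fact+
  show ?thesis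
    by (rule GG.subgroupI) (use assms in \<open>auto simp: diagonal_def\<close>)
qed

locale kstar_setup =
  fixes R :: "('r, 'l) ring_scheme" and G :: "('a, 'm) monoid_scheme"
    and H :: "('b, 'n) monoid_scheme" and K :: "('c, 'o) monoid_scheme"
  assumes R: "cring R"
    and G: "group G" "finite (carrier G)"
    and H: "group H" "finite (carrier H)"
    and K: "group K" "finite (carrier K)"
    and inv_H: "nat_in R (order H) \<in> Units R"
begin

interpretation R: cring R by (rule R)
interpretation GK: module R "RS R (G \<times>\<times> K)" by (rule free_module_module[OF R])

lemma kappa_closed: "kappa R G H K L M \<in> carrier R"
  using inv_H by (simp add: kappa_def)

lemma finite_pairs: "finite (subgroups_of (G \<times>\<times> H) \<times> subgroups_of (H \<times>\<times> K))"
  using G(2) H(2) K(2) by (simp add: finite_subgroups_of)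

lemma coeff_closed: "x \<in> carrier (RS R X) \<Longrightarrow> L \<in> subgroups_of X \<Longrightarrow> x L \<in> carrier R"
  by (auto simp: free_module_def)

lemma kstar_basis:
  assumes "subgroup L (G \<times>\<times> H)" "subgroup M (H \<times>\<times> K)"
  shows "kstar R G H K (sbasis R (G \<times>\<times> H) L) (sbasis R (H \<times>\<times> K) M) =
    kappa R G H K L M \<odot>\<^bsub>RS R (G \<times>\<times> K)\<^esub> sbasis R (G \<times>\<times> K) (star G H K L M)"
proof -
  let ?S = "subgroups_of (G \<times>\<times> H) \<times> subgroups_of (H \<times>\<times> K)"
  let ?f = "\<lambda>(L, M). kappa R G H K L M \<odot>\<^bsub>RS R (G \<times>\<times> K)\<^esub> sbasis R (G \<times>\<times> K) (star G H K L M)"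
  have "kstar R G H K (sbasis R (G \<times>\<times> H) L) (sbasis R (H \<times>\<times> K) M) =
    finsum (RS R (G \<times>\<times> K)) (\<lambda>p. if (L, M) = p then ?f p else \<zero>\<^bsub>RS R (G \<times>\<times> K)\<^esub>) ?S"
    unfolding kstar_def
    by (rule GK.finsum_cong')
      (auto simp: basis_elem_def[of R "subgroups_of (G \<times>\<times> H)"] basis_elem_def[of R "subgroups_of (H \<times>\<times> K)"]
        kappa_closed basis_elem_closed[OF R] GK.smult_l_null)
  also have "\<dots> = ?f (L, M)"
    by (rule GK.add.finprod_singleton)
      (use assms in \<open>auto simp: subgroups_of_def[symmetric] kappa_closed basis_elem_closed[OF R] finite_pairs\<close>,
       auto simp: subgroups_of_def)
  finally show ?thesis by simp
qed

lemma kstar_closed: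
  assumes "x \<in> carrier (RS R (G \<times>\<times> H))" "y \<in> carrier (RS R (H \<times>\<times> K))"
  shows "kstar R G H K x y \<in> carrier (RS R (G \<times>\<times> K))"
  unfolding kstar_def
  by (rule GK.finsum_closed) (use assms in \<open>auto simp: kappa_closed basis_elem_closed[OF R] coeff_closed\<close>)

lemma kstar_add_left:
  assumes "x \<in> carrier (RS R (G \<times>\<times> H))" "x' \<in> carrier (RS R (G \<times>\<times> H))" "y \<in> carrier (RS R (H \<times>\<times> K))"
  shows "kstar R G H K (x \<oplus>\<^bsub>RS R (G \<times>\<times> H)\<^esub> x') y =
    kstar R G H K x y \<oplus>\<^bsub>RS R (G \<times>\<times> K)\<^esub> kstar R G H K x' y"
  unfolding kstar_def
  by (subst GK.finsum_addf[symmetric], (use assms in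
      \<open>auto simp: kappa_closed basis_elem_closed[OF R] coeff_closed\<close>)[2], rule GK.finsum_cong')
    (use assms in \<open>auto simp: kappa_closed basis_elem_closed[OF R] coeff_closed
      GK.smult_l_distr[symmetric] R.l_distr free_module_add\<close>)

lemma kstar_add_right:
  assumes "x \<in> carrier (RS R (G \<times>\<times> H))" "y \<in> carrier (RS R (H \<times>\<times> K))" "y' \<in> carrier (RS R (H \<times>\<times> K))"
  shows "kstar R G H K x (y \<oplus>\<^bsub>RS R (H \<times>\<times> K)\<^esub> y') =
    kstar R G H K x y \<oplus>\<^bsub>RS R (G \<times>\<times> K)\<^esub> kstar R G H K x y'"
  unfolding kstar_def
  by (subst GK.finsum_addf[symmetric], (use assms in
      \<open>auto simp: kappa_closed basis_elem_closed[OF R] coeff_closed\<close>)[2], rule GK.finsum_cong')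
    (use assms in \<open>auto simp: kappa_closed basis_elem_closed[OF R] coeff_closed
      GK.smult_l_distr[symmetric] R.l_distr R.r_distr free_module_add\<close>)

lemma kstar_smult_left:
  assumes "a \<in> carrier R" "x \<in> carrier (RS R (G \<times>\<times> H))" "y \<in> carrier (RS R (H \<times>\<times> K))"
  shows "kstar R G H K (a \<odot>\<^bsub>RS R (G \<times>\<times> H)\<^esub> x) y = a \<odot>\<^bsub>RS R (G \<times>\<times> K)\<^esub> kstar R G H K x y"
  unfolding kstar_def
  by (subst GK.finsum_smult_ldistr[OF finite_pairs], (use assms in
      \<open>auto simp: kappa_closed basis_elem_closed[OF R] coeff_closed\<close>)[2], rule GK.finsum_cong')
    (use assms in \<open>auto simp: kappa_closed basis_elem_closed[OF R] coeff_closed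
      GK.smult_assoc1[symmetric] R.m_assoc free_module_smult\<close>)

lemma kstar_smult_right:
  assumes "a \<in> carrier R" "x \<in> carrier (RS R (G \<times>\<times> H))" "y \<in> carrier (RS R (H \<times>\<times> K))"
  shows "kstar R G H K x (a \<odot>\<^bsub>RS R (H \<times>\<times> K)\<^esub> y) = a \<odot>\<^bsub>RS R (G \<times>\<times> K)\<^esub> kstar R G H K x y"
  unfolding kstar_def
  by (subst GK.finsum_smult_ldistr[OF finite_pairs], (use assms in
      \<open>auto simp: kappa_closed basis_elem_closed[OF R] coeff_closed\<close>)[2], rule GK.finsum_cong')
    (use assms in \<open>auto simp: kappa_closed basis_elem_closed[OF R] coeff_closed
      GK.smult_assoc1[symmetric] R.m_ac free_module_smult\<close>)

end

end

theory Submission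
  imports Defs "HOL-Algebra.Divisibility"
begin

text \<open>
  Both sides of the cocycle relation count the same group in two ways. For \<open>L \<le> G \<times> H\<close>,
  \<open>M \<le> H \<times> K\<close> and \<open>N \<le> K \<times> I\<close> let \<open>W \<le> H \<times> K\<close> be the group of all \<open>(h, k) \<in> M\<close> with
  \<open>(1, h) \<in> L\<close> and \<open>(k, 1) \<in> N\<close>; it is the intersection of \<open>M\<close> with \<open>k2(L) \<times> k1(N)\<close>.
  Its projection to \<open>K\<close> has image \<open>k2(L * M) \<inter> k1(N)\<close> and kernel \<open>k2(L) \<inter> k1(M)\<close>, while its
  projection to \<open>H\<close> has image \<open>k2(L) \<inter> k1(M * N)\<close> and kernel \<open>k2(M) \<inter> k1(N)\<close>. Hence
  \<open>|k2(L) \<inter> k1(M)| |k2(L * M) \<inter> k1(N)| = |W| = |k2(L) \<inter> k1(M * N)| |k2(M) \<inter> k1(N)|\<close>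
  (\<open>card_middle_cocycle\<close>), and dividing by \<open>|H| |K|\<close> gives the relation. The values of \<open>\<kappa>\<close> are
  units because a subgroup order divides the group order, and a divisor of a unit is a unit.

  Since \<open>*\<close> is associative on subgroups, the cocycle relation is associativity of the twisted product
  on basis elements; a linear map on a free module is determined by its values on the basis
  (\<open>linear_eqI_free_module\<close>), so associativity holds everywhere. Finally \<open>\<Delta>(G)\<close> is neutral for \<open>*\<close>
  and \<open>k1(\<Delta>(G))\<close>, \<open>k2(\<Delta>(G))\<close> are trivial, so that \<open>\<kappa>(\<Delta>(G), L) = \<kappa>(L, \<Delta>(G)) = 1/|G|\<close>; the factor
  \<open>|G|\<close> in the identity element compensates this.
\<close>

section \<open>Counting along a homomorphism\<close>

text \<open>The first isomorphism theorem combined with Lagrange's theorem, for the restriction of a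
  homomorphism to a subgroup.\<close>

lemma (in group_hom) card_subgroup_eq_image_times_kernel:
  assumes "subgroup W G"
  shows "card W = card (h ` W) * card {w \<in> W. h w = \<one>\<^bsub>H\<^esub>}"
proof -
  let ?W = "G\<lparr>carrier := W\<rparr>" and ?hW = "H\<lparr>carrier := h ` W\<rparr>"
  have grp: "group ?W" "group ?hW"
    using subgroup.subgroup_is_group[OF assms] subgroup_img_is_subgroup[OF assms]
    by (auto intro: subgroup.subgroup_is_group)
  \<comment> \<open>The codomain is cut down to the image because the isomorphism theorem is for surjective maps.\<close>
  then interpret W: group_hom ?W ?hW h
    using subgroup.subset[OF assms]
    by (auto simp: group_hom_def group_hom_axioms_def hom_def subset_iff)
  have ker: "kernel ?W ?hW h = {w \<in> W. h w = \<one>\<^bsub>H\<^esub>}"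
    by (simp add: kernel_def)
  have "card (rcosets\<^bsub>?W\<^esub> kernel ?W ?hW h) = card (h ` W)"
    using W.FactGroup_iso_set by (auto simp: iso_def FactGroup_def dest: bij_betw_same_card)
  then show ?thesis
    using W.G.lagrange[OF W.subgroup_kernel] by (simp add: ker order_def)
qed

lemma group_hom_fst:
  assumes "group H" "group K" shows "group_hom (H \<times>\<times> K) H fst"
  using assms DirProd_group by (auto simp: group_hom_def group_hom_axioms_def hom_def)

lemma group_hom_snd:
  assumes "group H" "group K" shows "group_hom (H \<times>\<times> K) K snd"
  using assms DirProd_group by (auto simp: group_hom_def group_hom_axioms_def hom_def)

lemma card_subgroup_DirProd_fst:
  assumes "group H" "group K" "subgroup W (H \<times>\<times> K)"
  shows "card W = card (fst ` W) * card (k2 H K W)"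
proof -
  have "{w \<in> W. fst w = \<one>\<^bsub>H\<^esub>} = Pair \<one>\<^bsub>H\<^esub> ` k2 H K W"
    using subgroup.subset[OF assms(3)] by (auto simp: k2_def)
  then show ?thesis
    using group_hom.card_subgroup_eq_image_times_kernel[OF group_hom_fst[OF assms(1,2)] assms(3)]
    by (simp add: card_image inj_on_def)
qed

lemma card_subgroup_DirProd_snd:
  assumes "group H" "group K" "subgroup W (H \<times>\<times> K)"
  shows "card W = card (snd ` W) * card (k1 H K W)"
proof -
  have "{w \<in> W. snd w = \<one>\<^bsub>K\<^esub>} = (\<lambda>h. (h, \<one>\<^bsub>K\<^esub>)) ` k1 H K W"
    using subgroup.subset[OF assms(3)] by (auto simp: k1_def)
  then show ?thesis
    using group_hom.card_subgroup_eq_image_times_kernel[OF group_hom_snd[OF assms(1,2)] assms(3)]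
    by (simp add: card_image inj_on_def)
qed


section \<open>The cocycle relation\<close>

lemma subgroup_k1:
  assumes "group G" "group H" "subgroup L (G \<times>\<times> H)"
  shows "subgroup (k1 G H L) G"
proof -
  interpret G: group G by fact
  interpret H: group H by fact
  interpret L: subgroup L "G \<times>\<times> H" by fact
  show ?thesis
  proof (rule G.subgroupI, goal_cases)
    case 2
    show ?case using L.one_closed by (auto simp: k1_def)
  next
    case (3 a)
    then show ?case using L.m_inv_closed[of "(a, \<one>\<^bsub>H\<^esub>)"] assms(1,2) by (auto simp: k1_def)
  next
    case (4 a b)
    then show ?case using L.m_closed[of "(a, \<one>\<^bsub>H\<^esub>)" "(b, \<one>\<^bsub>H\<^esub>)"] by (auto simp: k1_def)
  qed (auto simp: k1_def)
qed

lemma subgroup_k2: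
  assumes "group G" "group H" "subgroup L (G \<times>\<times> H)"
  shows "subgroup (k2 G H L) H"
proof -
  interpret G: group G by fact
  interpret H: group H by fact
  interpret L: subgroup L "G \<times>\<times> H" by fact
  show ?thesis
  proof (rule H.subgroupI, goal_cases)
    case 2
    show ?case using L.one_closed by (auto simp: k2_def)
  next
    case (3 a)
    then show ?case using L.m_inv_closed[of "(\<one>\<^bsub>G\<^esub>, a)"] assms(1,2) by (auto simp: k2_def)
  next
    case (4 a b)
    then show ?case using L.m_closed[of "(\<one>\<^bsub>G\<^esub>, a)" "(\<one>\<^bsub>G\<^esub>, b)"] by (auto simp: k2_def)
  qed (auto simp: k2_def)
qed

lemma card_middle_cocycle:
  assumes "group G" "group H" "group K" "group I"
    and L: "subgroup L (G \<times>\<times> H)" and M: "subgroup M (H \<times>\<times> K)" and N: "subgroup N (K \<times>\<times> I)"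
  shows "card (k2 G H L \<inter> k1 H K M) * card (k2 G K (star G H K L M) \<inter> k1 K I N) =
    card (k2 G H L \<inter> k1 H I (star H K I M N)) * card (k2 H K M \<inter> k1 K I N)"
proof -
  interpret G: group G by fact
  interpret H: group H by fact
  interpret K: group K by fact
  interpret I: group I by fact
  interpret HK: group "H \<times>\<times> K" by (rule DirProd_group) fact+
  define W where "W = M \<inter> (k2 G H L \<times> k1 K I N)"
  have W: "subgroup W (H \<times>\<times> K)"
    unfolding W_def
    by (intro HK.subgroups_Inter_pair M DirProd_subgroups subgroup_k1 subgroup_k2) fact+
  \<comment> \<open>These make the condition on the trivial coordinate of a kernel element automatic.\<close>
  have one: "(\<one>\<^bsub>G\<^esub>, \<one>\<^bsub>H\<^esub>) \<in> L" "(\<one>\<^bsub>K\<^esub>, \<one>\<^bsub>I\<^esub>) \<in> N"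
    using subgroup.one_closed[OF L] subgroup.one_closed[OF N] by simp_all
  have "snd ` W = k2 G K (star G H K L M) \<inter> k1 K I N"
    by (force simp: W_def k1_def k2_def star_def image_iff)
  moreover have "fst ` W = k2 G H L \<inter> k1 H I (star H K I M N)"
    by (force simp: W_def k1_def k2_def star_def image_iff)
  moreover have "k1 H K W = k2 G H L \<inter> k1 H K M" "k2 H K W = k2 H K M \<inter> k1 K I N"
    using one by (auto simp: W_def k1_def k2_def)
  ultimately show ?thesis
    using card_subgroup_DirProd_fst[OF assms(2,3) W] card_subgroup_DirProd_snd[OF assms(2,3) W]
    by (simp add: mult.commute)
qed

lemma star_assoc:
  "star G K I (star G H K L M) N = star G H I L (star H K I M N)"
  by (auto simp: star_def)

lemma (in cring) nat_in_mult:
  "nat_in R (m * n) = nat_in R m \<otimes> nat_in R n"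
  by (simp add: add_pow_ldistr add.nat_pow_pow mult.commute)

lemma (in cring) nat_in_Units_dvd:
  assumes "m dvd n" "nat_in R n \<in> Units R"
  shows "nat_in R m \<in> Units R"
proof -
  obtain k where "n = m * k" using assms(1) by (rule dvdE)
  then show ?thesis
    using assms(2) unit_factor[of "nat_in R m" "nat_in R k"] by (simp add: nat_in_mult)
qed

lemma kappa_Units:
  assumes "cring R" "group G" "group H" "group K" "nat_in R (order H) \<in> Units R"
    and "subgroup L (G \<times>\<times> H)" "subgroup M (H \<times>\<times> K)"
  shows "kappa R G H K L M \<in> Units R"
proof -
  interpret R: cring R by fact
  interpret H: group H by fact
  have "subgroup (k2 G H L \<inter> k1 H K M) H"
    by (intro H.subgroups_Inter_pair subgroup_k1 subgroup_k2) fact+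
  then have "card (k2 G H L \<inter> k1 H K M) dvd order H"
    by (metis H.lagrange dvd_triv_right)
  then show ?thesis
    unfolding kappa_def using R.nat_in_Units_dvd assms(5) by blast
qed

lemma kappa_cocycle:
  assumes "cring R" "group G" "group H" "group K" "group I"
    and u: "nat_in R (order H) \<in> Units R" "nat_in R (order K) \<in> Units R"
    and "subgroup L (G \<times>\<times> H)" "subgroup M (H \<times>\<times> K)" "subgroup N (K \<times>\<times> I)"
  shows "kappa R G H K L M \<otimes>\<^bsub>R\<^esub> kappa R G K I (star G H K L M) N =
    kappa R G H I L (star H K I M N) \<otimes>\<^bsub>R\<^esub> kappa R H K I M N"
proof -
  interpret R: cring R by fact
  have frac: "(nat_in R a \<otimes>\<^bsub>R\<^esub> inv\<^bsub>R\<^esub> nat_in R (order H)) \<otimes>\<^bsub>R\<^esub> (nat_in R b \<otimes>\<^bsub>R\<^esub> inv\<^bsub>R\<^esub> nat_in R (order K)) =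
    nat_in R (a * b) \<otimes>\<^bsub>R\<^esub> (inv\<^bsub>R\<^esub> nat_in R (order H) \<otimes>\<^bsub>R\<^esub> inv\<^bsub>R\<^esub> nat_in R (order K))" for a b
    using u by (simp add: R.nat_in_mult R.m_ac del: R.add.nat_pow_mult)
  show ?thesis
    unfolding kappa_def frac card_middle_cocycle[OF assms(2-5,8-10)] ..
qed


section \<open>Linear maps on a free module\<close>

text \<open>A point \<open>a\<close> of the finite support of \<open>x\<close> is removed by splitting off the summand that is
  \<open>x a\<close> times the basis element of \<open>a\<close>.\<close>

lemma free_module_induct [consumes 2, case_names zero add]:
  assumes "cring R" and "x \<in> carrier (free_module R B)"
    and zero: "P \<zero>\<^bsub>free_module R B\<^esub>"
    and add: "\<And>r b y. \<lbrakk>r \<in> carrier R; b \<in> B; y \<in> carrier (free_module R B); P y\<rbrakk> \<Longrightarrow>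
      P ((r \<odot>\<^bsub>free_module R B\<^esub> basis_elem R B b) \<oplus>\<^bsub>free_module R B\<^esub> y)"
  shows "P x"
proof -
  interpret R: cring R by fact
  have "P x" if "finite A" "x \<in> carrier (free_module R B)" "{z \<in> B. x z \<noteq> \<zero>\<^bsub>R\<^esub>} \<subseteq> A" for A x
    using that
  proof (induction A arbitrary: x rule: finite_induct)
    case empty
    then have "x = \<zero>\<^bsub>free_module R B\<^esub>"
      by (auto simp: free_module_def PiE_iff extensional_def fun_eq_iff)
    then show ?case using zero by simp
  next
    case (insert a A)
    note x = free_moduleD[OF insert.prems(1)]
    let ?y = "\<lambda>z\<in>B. if z = a then \<zero>\<^bsub>R\<^esub> else x z"
    have y: "?y \<in> carrier (free_module R B)"
      by (rule free_module_closedI[where A = A])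
        (use x insert.prems(2) \<open>finite A\<close> in \<open>auto simp: PiE_iff\<close>)
    have Py: "P ?y"
      by (rule insert.IH[OF y]) (use insert.prems(2) in auto)
    show ?case
    proof (cases "a \<in> B")
      case True
      have "x = (x a \<odot>\<^bsub>free_module R B\<^esub> basis_elem R B a) \<oplus>\<^bsub>free_module R B\<^esub> ?y"
        using x(1) True
        by (auto simp: free_module_def basis_elem_def PiE_iff extensional_def fun_eq_iff)
      then show ?thesis
        using add[of "x a" a ?y] True y Py x(1) by (auto simp: PiE_iff)
    next
      case False
      then have "x = ?y"
        using x(1) by (auto simp: PiE_iff extensional_def fun_eq_iff)
      then show ?thesis using Py by simp
    qed
  qed
  then show ?thesis using assms(2) free_moduleD(2)[OF assms(2)] by blast
qed

lemma linear_eqI_free_module: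
  assumes "module R N" and x: "x \<in> carrier (free_module R B)"
    and "\<And>x. x \<in> carrier (free_module R B) \<Longrightarrow> f x \<in> carrier N"
    and "\<And>x. x \<in> carrier (free_module R B) \<Longrightarrow> g x \<in> carrier N"
    and f_add: "\<And>x y. \<lbrakk>x \<in> carrier (free_module R B); y \<in> carrier (free_module R B)\<rbrakk> \<Longrightarrow>
      f (x \<oplus>\<^bsub>free_module R B\<^esub> y) = f x \<oplus>\<^bsub>N\<^esub> f y"
    and g_add: "\<And>x y. \<lbrakk>x \<in> carrier (free_module R B); y \<in> carrier (free_module R B)\<rbrakk> \<Longrightarrow>
      g (x \<oplus>\<^bsub>free_module R B\<^esub> y) = g x \<oplus>\<^bsub>N\<^esub> g y"
    and f_smult: "\<And>a x. \<lbrakk>a \<in> carrier R; x \<in> carrier (free_module R B)\<rbrakk> \<Longrightarrow>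
      f (a \<odot>\<^bsub>free_module R B\<^esub> x) = a \<odot>\<^bsub>N\<^esub> f x"
    and g_smult: "\<And>a x. \<lbrakk>a \<in> carrier R; x \<in> carrier (free_module R B)\<rbrakk> \<Longrightarrow>
      g (a \<odot>\<^bsub>free_module R B\<^esub> x) = a \<odot>\<^bsub>N\<^esub> g x"
    and basis: "\<And>b. b \<in> B \<Longrightarrow> f (basis_elem R B b) = g (basis_elem R B b)"
  shows "f x = g x"
proof -
  interpret N: module R N by fact
  have R: "cring R" by (rule N.R.is_cring)
  interpret F: module R "free_module R B" by (rule free_module_module[OF R])
  show ?thesis
    using R x
  proof (induction x rule: free_module_induct)
    case zero
    \<comment> \<open>\<open>0 = 0 \<odot> 0\<close>, and linear maps preserve the right-hand side.\<close>
    show ?case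
      using f_smult[of "\<zero>\<^bsub>R\<^esub>" "\<zero>\<^bsub>free_module R B\<^esub>"] g_smult[of "\<zero>\<^bsub>R\<^esub>" "\<zero>\<^bsub>free_module R B\<^esub>"] assms(3,4)
      by simp
  next
    case (add r b y)
    then show ?case
      by (simp add: basis_elem_closed[OF R] f_add g_add f_smult g_smult basis)
  qed
qed


section \<open>The twisted product\<close>

lemma mem_subgroups_of: "S \<in> subgroups_of X \<longleftrightarrow> subgroup S X"
  by (simp add: subgroups_of_def)

lemma kstar_assoc_basis:
  assumes "kstar_setup R G H K" "kstar_setup R H K I"
    and G: "group G" "finite (carrier G)"
    and L: "subgroup L (G \<times>\<times> H)" and M: "subgroup M (H \<times>\<times> K)" and N: "subgroup N (K \<times>\<times> I)"
  shows "kstar R G K I (kstar R G H K (sbasis R (G \<times>\<times> H) L) (sbasis R (H \<times>\<times> K) M)) (sbasis R (K \<times>\<times> I) N) =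
    kstar R G H I (sbasis R (G \<times>\<times> H) L) (kstar R H K I (sbasis R (H \<times>\<times> K) M) (sbasis R (K \<times>\<times> I) N))"
proof -
  interpret GHK: kstar_setup R G H K by fact
  interpret HKI: kstar_setup R H K I by fact
  interpret GKI: kstar_setup R G K I
    using GHK.R GHK.G HKI.H HKI.K HKI.inv_H by (rule kstar_setup.intro)
  interpret GHI: kstar_setup R G H I
    using GHK.R GHK.G GHK.H HKI.K GHK.inv_H by (rule kstar_setup.intro)
  interpret M: module R "RS R (G \<times>\<times> I)" by (rule free_module_module[OF GHK.R])
  note b = basis_elem_closed[OF GHK.R]
  note s = star_subgroup[OF GHK.G(1) GHK.H(1) GHK.K(1) L M]
    star_subgroup[OF HKI.G(1) HKI.H(1) HKI.K(1) M N]
  have "kappa R G H K L M \<otimes>\<^bsub>R\<^esub> kappa R G K I (star G H K L M) N =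
      kappa R G H I L (star H K I M N) \<otimes>\<^bsub>R\<^esub> kappa R H K I M N"
    by (rule kappa_cocycle[OF GHK.R GHK.G(1) GHK.H(1) GHK.K(1) HKI.K(1) GHK.inv_H HKI.inv_H L M N])
  then show ?thesis
    using L M N s
    by (simp add: GHK.kstar_basis HKI.kstar_basis GKI.kstar_basis GHI.kstar_basis b
        GHK.kappa_closed HKI.kappa_closed GKI.kappa_closed GHI.kappa_closed
        GKI.kstar_smult_left GHI.kstar_smult_right star_assoc[of G K I H L M N]
        M.smult_assoc1[symmetric] M.R.m_comm)
qed

text \<open>Both sides are linear in each argument, so the arguments are replaced by basis elements one
  after the other.\<close>

lemma kstar_assoc:
  assumes "kstar_setup R G H K" "kstar_setup R H K I"
    and x: "x \<in> carrier (RS R (G \<times>\<times> H))" and y: "y \<in> carrier (RS R (H \<times>\<times> K))"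
    and z: "z \<in> carrier (RS R (K \<times>\<times> I))"
  shows "kstar R G K I (kstar R G H K x y) z = kstar R G H I x (kstar R H K I y z)"
proof -
  interpret GHK: kstar_setup R G H K by fact
  interpret HKI: kstar_setup R H K I by fact
  interpret GKI: kstar_setup R G K I
    using GHK.R GHK.G HKI.H HKI.K HKI.inv_H by (rule kstar_setup.intro)
  interpret GHI: kstar_setup R G H I
    using GHK.R GHK.G GHK.H HKI.K GHK.inv_H by (rule kstar_setup.intro)
  have mod: "module R (RS R (G \<times>\<times> I))" by (rule free_module_module[OF GHK.R])
  note b = basis_elem_closed[OF GHK.R]
  note simps = GHK.kstar_closed HKI.kstar_closed GKI.kstar_closed GHI.kstar_closed
    GHK.kstar_add_left GHK.kstar_add_right GHK.kstar_smult_left GHK.kstar_smult_right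
    HKI.kstar_add_left HKI.kstar_add_right HKI.kstar_smult_left HKI.kstar_smult_right
    GKI.kstar_add_left GKI.kstar_add_right GKI.kstar_smult_left GKI.kstar_smult_right
    GHI.kstar_add_left GHI.kstar_add_right GHI.kstar_smult_left GHI.kstar_smult_right
  have 1: "kstar R G K I (kstar R G H K (sbasis R (G \<times>\<times> H) L) (sbasis R (H \<times>\<times> K) M)) z =
      kstar R G H I (sbasis R (G \<times>\<times> H) L) (kstar R H K I (sbasis R (H \<times>\<times> K) M) z)"
    if "L \<in> subgroups_of (G \<times>\<times> H)" "M \<in> subgroups_of (H \<times>\<times> K)" for L M
    by (rule linear_eqI_free_module[OF mod z])
      (use that kstar_assoc_basis[OF assms(1,2) GHK.G, folded mem_subgroups_of] in \<open>auto simp: simps b\<close>)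
  have 2: "kstar R G K I (kstar R G H K (sbasis R (G \<times>\<times> H) L) y) z =
      kstar R G H I (sbasis R (G \<times>\<times> H) L) (kstar R H K I y z)"
    if "L \<in> subgroups_of (G \<times>\<times> H)" for L
    by (rule linear_eqI_free_module[OF mod y]) (use that 1 z in \<open>auto simp: simps b\<close>)
  show ?thesis
    by (rule linear_eqI_free_module[OF mod x]) (use 2 y z in \<open>auto simp: simps b\<close>)
qed


section \<open>The identity element\<close>

lemma star_diagonal_left:
  assumes "subgroup L (G \<times>\<times> H)" shows "star G G H (diagonal G) L = L"
  using subgroup.subset[OF assms] by (auto simp: star_def diagonal_def)

lemma star_diagonal_right:
  assumes "subgroup L (G \<times>\<times> H)" shows "star G H H L (diagonal H) = L"
  using subgroup.subset[OF assms] by (auto simp: star_def diagonal_def)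

lemma kappa_diagonal_left:
  assumes "cring R" "group G" "group H" "nat_in R (order G) \<in> Units R" "subgroup L (G \<times>\<times> H)"
  shows "kappa R G G H (diagonal G) L = inv\<^bsub>R\<^esub> nat_in R (order G)"
proof -
  interpret R: cring R by fact
  interpret G: group G by fact
  have "k2 G G (diagonal G) \<inter> k1 G H L = {\<one>\<^bsub>G\<^esub>}"
    using subgroup.one_closed[OF assms(5)] by (auto simp: k1_def k2_def diagonal_def)
  then show ?thesis using assms(4) by (simp add: kappa_def)
qed

lemma kappa_diagonal_right:
  assumes "cring R" "group G" "group H" "nat_in R (order H) \<in> Units R" "subgroup L (G \<times>\<times> H)"
  shows "kappa R G H H L (diagonal H) = inv\<^bsub>R\<^esub> nat_in R (order H)"
proof -
  interpret R: cring R by fact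
  interpret H: group H by fact
  have "k2 G H L \<inter> k1 H H (diagonal H) = {\<one>\<^bsub>H\<^esub>}"
    using subgroup.one_closed[OF assms(5)] by (auto simp: k1_def k2_def diagonal_def)
  then show ?thesis using assms(4) by (simp add: kappa_def)
qed

lemma kstar_diagonal_left:
  assumes "kstar_setup R G G H" and x: "x \<in> carrier (RS R (G \<times>\<times> H))"
  shows "kstar R G G H (nat_in R (order G) \<odot>\<^bsub>RS R (G \<times>\<times> G)\<^esub> sbasis R (G \<times>\<times> G) (diagonal G)) x = x"
proof -
  interpret S: kstar_setup R G G H by fact
  interpret M: module R "RS R (G \<times>\<times> H)" by (rule free_module_module[OF S.R])
  interpret GG: module R "RS R (G \<times>\<times> G)" by (rule free_module_module[OF S.R])
  note b = basis_elem_closed[OF S.R]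
  show ?thesis
  proof (rule linear_eqI_free_module[OF M.module_axioms x])
    fix L assume "L \<in> subgroups_of (G \<times>\<times> H)"
    then have L: "subgroup L (G \<times>\<times> H)" by (simp add: mem_subgroups_of)
    show "kstar R G G H (nat_in R (order G) \<odot>\<^bsub>RS R (G \<times>\<times> G)\<^esub> sbasis R (G \<times>\<times> G) (diagonal G))
        (sbasis R (G \<times>\<times> H) L) = sbasis R (G \<times>\<times> H) L"
      using S.inv_H L
      by (simp add: b S.kstar_smult_left S.kstar_basis diagonal_subgroup S.G star_diagonal_left
          kappa_diagonal_left[OF S.R S.G(1) S.K(1) S.inv_H L] M.smult_assoc1[symmetric])
  qed (auto simp: b S.kstar_closed S.kstar_add_right S.kstar_smult_right)
qed

lemma kstar_diagonal_right:
  assumes "kstar_setup R G H H" and x: "x \<in> carrier (RS R (G \<times>\<times> H))"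
  shows "kstar R G H H x (nat_in R (order H) \<odot>\<^bsub>RS R (H \<times>\<times> H)\<^esub> sbasis R (H \<times>\<times> H) (diagonal H)) = x"
proof -
  interpret S: kstar_setup R G H H by fact
  interpret M: module R "RS R (G \<times>\<times> H)" by (rule free_module_module[OF S.R])
  interpret HH: module R "RS R (H \<times>\<times> H)" by (rule free_module_module[OF S.R])
  note b = basis_elem_closed[OF S.R]
  show ?thesis
  proof (rule linear_eqI_free_module[OF M.module_axioms x])
    fix L assume "L \<in> subgroups_of (G \<times>\<times> H)"
    then have L: "subgroup L (G \<times>\<times> H)" by (simp add: mem_subgroups_of)
    show "kstar R G H H (sbasis R (G \<times>\<times> H) L)
        (nat_in R (order H) \<odot>\<^bsub>RS R (H \<times>\<times> H)\<^esub> sbasis R (H \<times>\<times> H) (diagonal H)) = sbasis R (G \<times>\<times> H) L"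
      using S.inv_H L
      by (simp add: b S.kstar_smult_right S.kstar_basis diagonal_subgroup S.H star_diagonal_right
          kappa_diagonal_right[OF S.R S.G(1) S.H(1) S.inv_H L] M.smult_assoc1[symmetric])
  qed (auto simp: b S.kstar_closed S.kstar_add_left S.kstar_smult_left)
qed

lemma assoc_algebra_kstar:
  assumes "kstar_setup R G G G"
  shows "assoc_algebra R ((RS R (G \<times>\<times> G))
    \<lparr>mult := kstar R G G G,
     one := nat_in R (order G) \<odot>\<^bsub>RS R (G \<times>\<times> G)\<^esub> sbasis R (G \<times>\<times> G) (diagonal G)\<rparr>)"
    (is "assoc_algebra R ?A")
proof -
  interpret S: kstar_setup R G G G by fact
  interpret M: module R "RS R (G \<times>\<times> G)" by (rule free_module_module[OF S.R])
  have ag: "abelian_group ?A"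
  proof (rule abelian_groupI)
    fix x assume "x \<in> carrier ?A"
    then show "\<exists>y\<in>carrier ?A. y \<oplus>\<^bsub>?A\<^esub> x = \<zero>\<^bsub>?A\<^esub>"
      using M.M.l_neg by (intro bexI[of _ "\<ominus>\<^bsub>RS R (G \<times>\<times> G)\<^esub> x"]) auto
  qed (auto simp: M.M.a_ac)
  have mod: "module R ?A"
    by (rule moduleI[OF S.R ag]) (auto simp: M.smult_l_distr M.smult_r_distr M.smult_assoc1)
  have "monoid ?A"
    by (rule monoidI)
      (auto simp: S.kstar_closed basis_elem_closed[OF S.R] kstar_assoc[OF assms assms]
        kstar_diagonal_left[OF assms] kstar_diagonal_right[OF assms])
  then have "ring ?A"
    by (intro ringI[OF ag]) (auto simp: S.kstar_add_left S.kstar_add_right)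
  with mod show ?thesis
    by (intro assoc_algebra.intro assoc_algebra_axioms.intro)
      (auto simp: S.kstar_smult_left S.kstar_smult_right)
qed

theorem proposition3p5:
  fixes R :: "('r, 'l) ring_scheme"
    and G :: "('a, 'm) monoid_scheme" and H :: "('b, 'n) monoid_scheme"
    and K :: "('c, 'o) monoid_scheme" and I :: "('d, 'p) monoid_scheme"
  assumes "group G" "finite (carrier G)" and "group H" "finite (carrier H)"
    and "group K" "finite (carrier K)" and "group I" "finite (carrier I)"
    and "cring R"
    and "nat_in R (order H) \<in> Units R" and "nat_in R (order K) \<in> Units R"
  shows
    "(\<forall>L M N. subgroup L (G \<times>\<times> H) \<and> subgroup M (H \<times>\<times> K) \<and> subgroup N (K \<times>\<times> I) \<longrightarrow>
        kappa R G H K L M \<in> Units R \<and>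
        kappa R G K I (star G H K L M) N \<in> Units R \<and>
        kappa R G H I L (star H K I M N) \<in> Units R \<and>
        kappa R H K I M N \<in> Units R \<and>
        kappa R G H K L M \<otimes>\<^bsub>R\<^esub> kappa R G K I (star G H K L M) N =
          kappa R G H I L (star H K I M N) \<otimes>\<^bsub>R\<^esub> kappa R H K I M N \<and>
        kstar R G K I (kstar R G H K (sbasis R (G \<times>\<times> H) L) (sbasis R (H \<times>\<times> K) M))
            (sbasis R (K \<times>\<times> I) N) =
          kstar R G H I (sbasis R (G \<times>\<times> H) L)
            (kstar R H K I (sbasis R (H \<times>\<times> K) M) (sbasis R (K \<times>\<times> I) N))) \<and>
     (\<forall>x\<in>carrier (RS R (G \<times>\<times> H)). \<forall>y\<in>carrier (RS R (H \<times>\<times> K)). \<forall>z\<in>carrier (RS R (K \<times>\<times> I)).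
        kstar R G K I (kstar R G H K x y) z = kstar R G H I x (kstar R H K I y z)) \<and>
     (nat_in R (order G) \<in> Units R \<longrightarrow>
        assoc_algebra R ((RS R (G \<times>\<times> G))
          \<lparr>mult := kstar R G G G,
           one := nat_in R (order G) \<odot>\<^bsub>RS R (G \<times>\<times> G)\<^esub> sbasis R (G \<times>\<times> G) (diagonal G)\<rparr>))"
proof (intro conjI allI ballI impI; (elim conjE)?)
  have GHK: "kstar_setup R G H K" and HKI: "kstar_setup R H K I"
    using assms by (simp_all add: kstar_setup_def)
  {
    fix L M N
    assume L: "subgroup L (G \<times>\<times> H)" and M: "subgroup M (H \<times>\<times> K)" and N: "subgroup N (K \<times>\<times> I)"
    show "kappa R G H K L M \<in> Units R" "kappa R G K I (star G H K L M) N \<in> Units R"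
        "kappa R G H I L (star H K I M N) \<in> Units R" "kappa R H K I M N \<in> Units R"
      by (intro kappa_Units star_subgroup assms L M N)+
    show "kappa R G H K L M \<otimes>\<^bsub>R\<^esub> kappa R G K I (star G H K L M) N =
        kappa R G H I L (star H K I M N) \<otimes>\<^bsub>R\<^esub> kappa R H K I M N"
      by (intro kappa_cocycle assms L M N)
    show "kstar R G K I (kstar R G H K (sbasis R (G \<times>\<times> H) L) (sbasis R (H \<times>\<times> K) M))
          (sbasis R (K \<times>\<times> I) N) =
        kstar R G H I (sbasis R (G \<times>\<times> H) L)
          (kstar R H K I (sbasis R (H \<times>\<times> K) M) (sbasis R (K \<times>\<times> I) N))"
      by (rule kstar_assoc_basis[OF GHK HKI assms(1,2) L M N])
  }
  show "kstar R G K I (kstar R G H K x y) z = kstar R G H I x (kstar R H K I y z)"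
    if "x \<in> carrier (RS R (G \<times>\<times> H))" "y \<in> carrier (RS R (H \<times>\<times> K))"
      "z \<in> carrier (RS R (K \<times>\<times> I))" for x y z
    by (rule kstar_assoc[OF GHK HKI that])
  show "assoc_algebra R ((RS R (G \<times>\<times> G))
      \<lparr>mult := kstar R G G G,
       one := nat_in R (order G) \<odot>\<^bsub>RS R (G \<times>\<times> G)\<^esub> sbasis R (G \<times>\<times> G) (diagonal G)\<rparr>)"
    if "nat_in R (order G) \<in> Units R"
    using assms that by (intro assoc_algebra_kstar) (simp add: kstar_setup_def)
qed

end
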